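(* Let $\mathrm{Var}$ be a denumerable set of propositional variables, let $\Gamma$ be an arbitrary (possibly infinite) set of monoidal functional dependencies over $\mathrm{Var}$, and let $A \Rightarrow B$ be a monoidal functional dependency over $\mathrm{Var}$. Then $\Gamma \vdash A \Rightarrow B$ if and only if $\Gamma \models A \Rightarrow B$, where $\vdash$ is provability using the rules (Ax) and (Cut) and $\models$ is semantic entailment over all integral commutative pomonoids.
   Context: Let $\mathrm{Var}$ be a fixed denumerable set (propositional variables). A finite multiset over $\mathrm{Var}$ is a map $A\colon \mathrm{Var} \to \mathbb{Z}$ with $A(p) \ge 0$ for all $p$ and $\{p : A(p) > 0\}$ finite. The multiset $\top$ is the constantly zero map; $AB$ denotes the multiset $(AB)(p) = A(p)+B(p)$. A monoidal functional dependency (MFD) is an expression $A \Rightarrow B$ with $A,B$ finite multisets over $\mathrm{Var}$. A theory is a set of MFDs. Semantics: an integral commutative pomonoid is $\mathbf{L} = \langle L,\le,\otimes,1\rangle$ where $\langle L,\otimes,1\rangle$ is a commutative monoid, $\le$ is a partial order on $L$, $\otimes$ is monotone with respect to $\le$ ($a \le b$ implies $a\otimes c \le b \otimes c$), and $1$ is the greatest element. Powers: $a^0=1$, $a^{n+1} = a \otimes a^n$. An $\mathbf{L}$-evaluation is a map $e\colon \mathrm{Var} \to L$, extended to multisets by $e(A) = e(p_1)^{A(p_1)} \otimes\cdots\otimes e(p_n)^{A(p_n)}$ where $\{p : A(p)>0\} \subseteq \{p_1,\dots,p_n\}$ ($p_i$ distinct). Write $e \models A \Rightarrow B$ if $e(A)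 \le e(B)$. An $\mathbf{L}$-model of $\Gamma$ is an $\mathbf{L}$-evaluation $e$ with $e \models E \Rightarrow F$ for all $E \Rightarrow F \in \Gamma$. $\Gamma \models A \Rightarrow B$ means: for every integral commutative pomonoid $\mathbf{L}$ and every $\mathbf{L}$-model $e$ of $\Gamma$, $e \models A \Rightarrow B$. Provability: the inference rules are, for arbitrary finite multisets $A,B,C,D$: (Ax) infer $AB \Rightarrow B$ (from no premises); (Cut) from $A \Rightarrow B$ and $BC \Rightarrow D$ infer $AC \Rightarrow D$. A proof of $\varphi_n$ by $\Gamma$ is a finite sequence $\varphi_1,\dots,\varphi_n$ of MFDs in which each $\varphi_i$ is in $\Gamma$ or is derived from $\varphi_1,\dots,\varphi_{i-1}$ by (Ax) or (Cut). $\Gamma \vdash A \Rightarrow B$ means there is a proof of $A \Rightarrow B$ by $\Gamma$. *)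

theory Defs
  imports "HOL-Algebra.FiniteProduct" "HOL-Library.Multiset" "HOL-Library.Countable_Set"
begin

datatype 'v mfd = MFD (lhs: "'v multiset") (rhs: "'v multiset") (infix "\<Rrightarrow>" 55)


text \<open>A proof is a nonempty list of dependencies, each one a hypothesis, an instance of (Ax),
  or obtained by (Cut) from two strictly earlier entries (in either order, possibly equal).\<close>

definition is_axiom :: "'v mfd \<Rightarrow> bool" where
  "is_axiom \<phi> \<longleftrightarrow> (\<exists>A B. \<phi> = (A + B \<Rrightarrow> B))"

definition is_cut :: "'v mfd \<Rightarrow> 'v mfd \<Rightarrow> 'v mfd \<Rightarrow> bool" where
  "is_cut \<phi>\<^sub>1 \<phi>\<^sub>2 \<psi> \<longleftrightarrow>
     (\<exists>A B C D. \<phi>\<^sub>1 = (A \<Rrightarrow> B) \<and> \<phi>\<^sub>2 = (B + C \<Rrightarrow> D) \<and> \<psi> = (A + C \<Rrightarrow> D))"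

definition is_proof :: "'v mfd set \<Rightarrow> 'v mfd list \<Rightarrow> bool" where
  "is_proof \<Gamma> \<phi>s \<longleftrightarrow>
     (\<forall>i < length \<phi>s. \<phi>s ! i \<in> \<Gamma> \<or> is_axiom (\<phi>s ! i) \<or>
        (\<exists>j < i. \<exists>k < i. is_cut (\<phi>s ! j) (\<phi>s ! k) (\<phi>s ! i)))"

definition provable :: "'v mfd set \<Rightarrow> 'v mfd \<Rightarrow> bool" (infix "\<turnstile>" 50) where
  "\<Gamma> \<turnstile> \<phi> \<longleftrightarrow> (\<exists>\<phi>s. is_proof \<Gamma> \<phi>s \<and> \<phi>s \<noteq> [] \<and> last \<phi>s = \<phi>)"


text \<open>The order of a pomonoid is a relation on the carrier, not on the whole type.\<close>

record 'a pomonoid = "'a monoid" +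
  leq :: "('a \<times> 'a) set"

locale integral_comm_pomonoid = comm_monoid L for L :: "'a pomonoid" (structure) +
  assumes leq_partial_order: "partial_order_on (carrier L) (leq L)"
    and mult_leq_mono:
      "\<lbrakk>(a, b) \<in> leq L; c \<in> carrier L\<rbrakk> \<Longrightarrow> (a \<otimes> c, b \<otimes> c) \<in> leq L"
    and one_greatest: "a \<in> carrier L \<Longrightarrow> (a, \<one>) \<in> leq L"

definition eval_mset :: "'a pomonoid \<Rightarrow> ('v \<Rightarrow> 'a) \<Rightarrow> 'v multiset \<Rightarrow> 'a" where
  "eval_mset L e A = (\<Otimes>\<^bsub>L\<^esub>p\<in>set_mset A. e p [^]\<^bsub>L\<^esub> count A p)"

definition satisfies :: "'a pomonoid \<Rightarrow> ('v \<Rightarrow> 'a) \<Rightarrow> 'v mfd \<Rightarrow> bool" where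
  "satisfies L e \<phi> \<longleftrightarrow> (eval_mset L e (lhs \<phi>), eval_mset L e (rhs \<phi>)) \<in> leq L"

definition is_model :: "'a pomonoid \<Rightarrow> ('v \<Rightarrow> 'a) \<Rightarrow> 'v mfd set \<Rightarrow> bool" where
  "is_model L e \<Gamma> \<longleftrightarrow> range e \<subseteq> carrier L \<and> (\<forall>\<phi>\<in>\<Gamma>. satisfies L e \<phi>)"

text \<open>HOL cannot quantify over types inside a formula, so entailment takes as a parameter the type
  from which the carriers of the pomonoids are drawn. The carrier may be any subset of that type;
  hence any infinite type provides isomorphic copies of all finite and countable pomonoids, and
  a statement for all infinite types covers pomonoids of every cardinality.\<close>

definition entails :: "'a itself \<Rightarrow> 'v mfd set \<Rightarrow> 'v mfd \<Rightarrow> bool" where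
  "entails (_ :: 'a itself) \<Gamma> \<phi> \<longleftrightarrow>
     (\<forall>(L :: 'a pomonoid) e. integral_comm_pomonoid L \<longrightarrow> is_model L e \<Gamma> \<longrightarrow> satisfies L e \<phi>)"

end

theory Submission
  imports Defs
begin

text \<open>Completeness is the Lindenbaum construction: multisets modulo interderivability form an
  integral commutative pomonoid, ordered by derivability, in which a dependency holds under the
  canonical evaluation iff it is derivable. As there are only countably many multisets over a
  countable set, this pomonoid can be realized on a subset of any infinite type.\<close>

section \<open>Proofs as lists, and derived rules\<close>

text \<open>Premises always lie strictly earlier, so appending an entry leaves the conditions on the
  old entries unchanged. Indices give way to membership in \<open>set \<phi>s\<close>, which suits
  \<open>rev_induct\<close>.\<close>

lemma is_proof_snoc:
  "is_proof \<Gamma> (\<phi>s @ [\<psi>]) \<longleftrightarrow> is_proof \<Gamma> \<phi>s \<and>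
     (\<psi> \<in> \<Gamma> \<or> is_axiom \<psi> \<or> (\<exists>\<alpha>\<in>set \<phi>s. \<exists>\<beta>\<in>set \<phi>s. is_cut \<alpha> \<beta> \<psi>))"
proof -
  have nth: "(\<phi>s @ [\<psi>]) ! i = \<phi>s ! i" if "i < length \<phi>s" for i
    using that by (simp add: nth_append)
  \<comment> \<open>The case \<open>i = length \<phi>s\<close> is included: even for the new entry
    itself, the premises are looked up among the old entries.\<close>
  have cut: "(\<exists>j<i. \<exists>k<i. is_cut ((\<phi>s @ [\<psi>]) ! j) ((\<phi>s @ [\<psi>]) ! k) \<chi>) \<longleftrightarrow>
      (\<exists>j<i. \<exists>k<i. is_cut (\<phi>s ! j) (\<phi>s ! k) \<chi>)" if "i \<le> length \<phi>s" for i \<chi>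
    using that nth by (metis less_le_trans)
  have set: "(\<exists>j<length \<phi>s. \<exists>k<length \<phi>s. is_cut (\<phi>s ! j) (\<phi>s ! k) \<psi>) \<longleftrightarrow>
      (\<exists>\<alpha>\<in>set \<phi>s. \<exists>\<beta>\<in>set \<phi>s. is_cut \<alpha> \<beta> \<psi>)"
    by (metis in_set_conv_nth)
  show ?thesis
    by (simp add: is_proof_def All_less_Suc nth cut set conj_commute cong: imp_cong)
qed

lemma is_proof_append: "\<lbrakk>is_proof \<Gamma> \<phi>s; is_proof \<Gamma> \<psi>s\<rbrakk> \<Longrightarrow> is_proof \<Gamma> (\<phi>s @ \<psi>s)"
proof (induction \<psi>s rule: rev_induct)
  case (snoc \<psi> \<psi>s)
  then have "is_proof \<Gamma> ((\<phi>s @ \<psi>s) @ [\<psi>])"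
    unfolding is_proof_snoc set_append by blast
  then show ?case by simp
qed simp

text \<open>The property is carried along for every entry of the proof, since a cut may refer to any
  earlier one; the last entry is then a special case.\<close>

lemma provable_induct [consumes 1, case_names hyp ax cut]:
  assumes "\<Gamma> \<turnstile> \<phi>"
    and hyp: "\<And>\<psi>. \<psi> \<in> \<Gamma> \<Longrightarrow> P \<psi>"
    and ax: "\<And>A B. P (A + B \<Rrightarrow> B)"
    and cut: "\<And>A B C D. \<lbrakk>P (A \<Rrightarrow> B); P (B + C \<Rrightarrow> D)\<rbrakk> \<Longrightarrow> P (A + C \<Rrightarrow> D)"
  shows "P \<phi>"
proof -
  have "\<forall>\<psi>\<in>set \<phi>s. P \<psi>" if "is_proof \<Gamma> \<phi>s" for \<phi>s
    using that
  proof (induction \<phi>s rule: rev_induct)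
    case (snoc \<psi> \<phi>s)
    then have IH: "\<forall>\<psi>\<in>set \<phi>s. P \<psi>" by (simp add: is_proof_snoc)
    from snoc.prems consider "\<psi> \<in> \<Gamma>" | "is_axiom \<psi>"
      | \<alpha> \<beta> where "\<alpha> \<in> set \<phi>s" "\<beta> \<in> set \<phi>s" "is_cut \<alpha> \<beta> \<psi>"
      unfolding is_proof_snoc by blast
    then have "P \<psi>"
      by cases (use IH in \<open>auto simp: is_axiom_def is_cut_def intro: hyp ax cut\<close>)
    with IH show ?case by simp
  qed simp
  with assms(1) show ?thesis unfolding provable_def using last_in_set by blast
qed

lemma provable_hyp: "\<phi> \<in> \<Gamma> \<Longrightarrow> \<Gamma> \<turnstile> \<phi>"
  unfolding provable_def by (intro exI[of _ "[\<phi>]"]) (simp add: is_proof_def)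

lemma provable_ax: "\<Gamma> \<turnstile> (A + B \<Rrightarrow> B)"
  unfolding provable_def by (intro exI[of _ "[A + B \<Rrightarrow> B]"]) (auto simp: is_proof_def is_axiom_def)

text \<open>Concatenating the two proofs makes both premises available to one further cut.\<close>

lemma provable_cut:
  assumes "\<Gamma> \<turnstile> (A \<Rrightarrow> B)" "\<Gamma> \<turnstile> (B + C \<Rrightarrow> D)"
  shows "\<Gamma> \<turnstile> (A + C \<Rrightarrow> D)"
proof -
  obtain \<phi>s \<psi>s where *: "is_proof \<Gamma> \<phi>s" "\<phi>s \<noteq> []" "last \<phi>s = (A \<Rrightarrow> B)"
    "is_proof \<Gamma> \<psi>s" "\<psi>s \<noteq> []" "last \<psi>s = (B + C \<Rrightarrow> D)"
    using assms unfolding provable_def by blast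
  then have "(A \<Rrightarrow> B) \<in> set (\<phi>s @ \<psi>s)" "(B + C \<Rrightarrow> D) \<in> set (\<phi>s @ \<psi>s)"
    using last_in_set[of \<phi>s] last_in_set[of \<psi>s] by simp_all
  moreover have "is_cut (A \<Rrightarrow> B) (B + C \<Rrightarrow> D) (A + C \<Rrightarrow> D)"
    unfolding is_cut_def by blast
  ultimately have "is_proof \<Gamma> ((\<phi>s @ \<psi>s) @ [A + C \<Rrightarrow> D])"
    using * unfolding is_proof_snoc by (blast intro: is_proof_append)
  then show ?thesis unfolding provable_def by (metis last_snoc snoc_eq_iff_butlast)
qed

lemma provable_refl: "\<Gamma> \<turnstile> (A \<Rrightarrow> A)"
  using provable_ax[of \<Gamma> "{#}" A] by simp

lemma provable_trans: "\<lbrakk>\<Gamma> \<turnstile> (A \<Rrightarrow> B); \<Gamma> \<turnstile> (B \<Rrightarrow> C)\<rbrakk> \<Longrightarrow> \<Gamma> \<turnstile> (A \<Rrightarrow> C)"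
  using provable_cut[of \<Gamma> A B "{#}" C] by simp

lemma provable_mono: "\<Gamma> \<turnstile> (A \<Rrightarrow> B) \<Longrightarrow> \<Gamma> \<turnstile> (A + C \<Rrightarrow> B + C)"
  by (rule provable_cut[OF _ provable_refl])

lemma provable_empty: "\<Gamma> \<turnstile> (A \<Rrightarrow> {#})"
  using provable_ax[of \<Gamma> A "{#}"] by simp

section \<open>Evaluation of multisets and soundness\<close>

context integral_comm_pomonoid
begin

lemma leq_trans: "\<lbrakk>(a, b) \<in> leq L; (b, c) \<in> leq L\<rbrakk> \<Longrightarrow> (a, c) \<in> leq L"
  using leq_partial_order unfolding partial_order_on_def preorder_on_def by (meson transD)

context
  fixes e :: "'v \<Rightarrow> 'a"
  assumes e: "range e \<subseteq> carrier L"
begin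

lemma eval_mset_closed: "eval_mset L e A \<in> carrier L"
  unfolding eval_mset_def using e by (intro finprod_closed) auto

text \<open>Variables outside \<open>A\<close> have exponent 0 and contribute the factor \<one>.
  This lets products for different multisets run over a common index set.\<close>

lemma eval_mset_superset:
  assumes "finite S" "set_mset A \<subseteq> S"
  shows "eval_mset L e A = (\<Otimes>p\<in>S. e p [^] count A p)"
  unfolding eval_mset_def using assms e
  by (intro finprod_mono_neutral_cong_left) (auto simp: not_in_iff range_subsetD)

lemma eval_mset_union: "eval_mset L e (A + B) = eval_mset L e A \<otimes> eval_mset L e B"
proof -
  let ?S = "set_mset A \<union> set_mset B"
  have "eval_mset L e (A + B) = (\<Otimes>p\<in>?S. e p [^] count A p \<otimes> e p [^] count B p)"
    using e by (subst eval_mset_superset[of ?S])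
      (auto simp: nat_pow_mult image_subset_iff intro!: finprod_cong')
  also have "\<dots> = (\<Otimes>p\<in>?S. e p [^] count A p) \<otimes> (\<Otimes>p\<in>?S. e p [^] count B p)"
    using e by (intro finprod_multf) auto
  also have "\<dots> = eval_mset L e A \<otimes> eval_mset L e B"
    by (simp add: eval_mset_superset[of ?S])
  finally show ?thesis .
qed

lemma eval_mset_single: "eval_mset L e {#p#} = e p"
  using e by (simp add: eval_mset_def range_subsetD)

end

text \<open>Integrality and monotonicity validate (Ax); monotonicity and transitivity validate
  (Cut).\<close>

theorem soundness:
  assumes "\<Gamma> \<turnstile> \<phi>" "is_model L e \<Gamma>"
  shows "satisfies L e \<phi>"
proof -
  have e: "range e \<subseteq> carrier L" using assms(2) by (simp add: is_model_def)
  note [simp] = eval_mset_closed[OF e] eval_mset_union[OF e]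
  show ?thesis using assms(1)
  proof (induction rule: provable_induct)
    case (hyp \<psi>)
    then show ?case using assms(2) by (simp add: is_model_def)
  next
    case (ax A B)
    \<comment> \<open>The value of \<open>A\<close> lies below \<one>; multiply both sides by the
      value of \<open>B\<close>.\<close>
    have "(eval_mset L e A \<otimes> eval_mset L e B, \<one> \<otimes> eval_mset L e B) \<in> leq L"
      by (intro mult_leq_mono one_greatest) simp_all
    then show ?case by (simp add: satisfies_def)
  next
    case (cut A B C D)
    then have "(eval_mset L e A \<otimes> eval_mset L e C, eval_mset L e B \<otimes> eval_mset L e C) \<in> leq L"
      by (intro mult_leq_mono) (simp_all add: satisfies_def)
    with cut show ?case by (auto simp: satisfies_def intro: leq_trans)
  qed
qed

end

section \<open>The Lindenbaum pomonoid\<close>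

text \<open>The value \<open>h A\<close> stands for the class of \<open>A\<close>: the kernel of \<open>h\<close> will be interderivability, and
  \<open>inv_into UNIV h\<close> picks a representative of each class.\<close>

definition lindenbaum :: "'v mfd set \<Rightarrow> ('v multiset \<Rightarrow> 'a) \<Rightarrow> 'a pomonoid" where
  "lindenbaum \<Gamma> h = \<lparr>carrier = range h, monoid.mult = (\<lambda>x y. h (inv_into UNIV h x + inv_into UNIV h y)), one = h {#},
     leq = {(h A, h B) | A B. \<Gamma> \<turnstile> (A \<Rrightarrow> B)}\<rparr>"

context
  fixes \<Gamma> :: "'v mfd set" and h :: "'v multiset \<Rightarrow> 'a"
  assumes kernel: "\<And>A B. h A = h B \<longleftrightarrow> \<Gamma> \<turnstile> (A \<Rrightarrow> B) \<and> \<Gamma> \<turnstile> (B \<Rrightarrow> A)"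
begin

lemma carrier_lindenbaum: "carrier (lindenbaum \<Gamma> h) = range h"
  and one_lindenbaum: "\<one>\<^bsub>lindenbaum \<Gamma> h\<^esub> = h {#}"
  by (simp_all add: lindenbaum_def)

lemma leq_lindenbaumE:
  assumes "(x, y) \<in> leq (lindenbaum \<Gamma> h)"
  obtains A B where "x = h A" "y = h B" "\<Gamma> \<turnstile> (A \<Rrightarrow> B)"
  using assms by (auto simp: lindenbaum_def)

text \<open>The order is defined through some pair of representatives; since equal values of
  \<open>h\<close> mean interderivability, transitivity moves derivability to any other
  pair.\<close>

lemma leq_lindenbaum: "(h A, h B) \<in> leq (lindenbaum \<Gamma> h) \<longleftrightarrow> \<Gamma> \<turnstile> (A \<Rrightarrow> B)"
proof
  assume "(h A, h B) \<in> leq (lindenbaum \<Gamma> h)"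
  then obtain A' B' where "h A = h A'" "h B = h B'" "\<Gamma> \<turnstile> (A' \<Rrightarrow> B')"
    by (rule leq_lindenbaumE)
  then show "\<Gamma> \<turnstile> (A \<Rrightarrow> B)"
    unfolding kernel by (blast intro: provable_trans)
qed (auto simp: lindenbaum_def)

text \<open>The representatives picked by \<open>inv_into\<close> may differ from \<open>A\<close>
  and \<open>B\<close>, but interderivability is a congruence for multiset union, so the class of
  the union is the same.\<close>

lemma mult_lindenbaum: "h A \<otimes>\<^bsub>lindenbaum \<Gamma> h\<^esub> h B = h (A + B)"
proof -
  have *: "h (A + C) = h (B + C)" if "h A = h B" for A B C
    using that by (simp add: kernel provable_mono)
  have "h (inv_into UNIV h (h A) + inv_into UNIV h (h B)) = h (A + inv_into UNIV h (h B))"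
    by (rule *) (simp add: f_inv_into_f)
  also have "\<dots> = h (A + B)"
    using *[of "inv_into UNIV h (h B)" B A] by (simp add: f_inv_into_f add.commute)
  finally show ?thesis by (simp add: lindenbaum_def)
qed

text \<open>The monoid laws come from multiset union and the order laws from the derived rules;
  antisymmetry is exactly the assumption on the kernel of \<open>h\<close>.\<close>

lemma integral_comm_pomonoid_lindenbaum: "integral_comm_pomonoid (lindenbaum \<Gamma> h)"
proof -
  let ?L = "lindenbaum \<Gamma> h"
  note [simp] = carrier_lindenbaum one_lindenbaum leq_lindenbaum mult_lindenbaum
  interpret comm_monoid ?L
    by (rule comm_monoidI) (auto simp: add.commute add.left_commute)
  show ?thesis
  proof
    show "partial_order_on (carrier ?L) (leq ?L)"
      unfolding partial_order_on_def preorder_on_def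
    proof (intro conjI)
      show "leq ?L \<subseteq> carrier ?L \<times> carrier ?L"
        by (auto elim: leq_lindenbaumE)
      show "refl_on (carrier ?L) (leq ?L)"
        by (auto simp: refl_on_def provable_refl)
      show "trans (leq ?L)"
      proof (rule transI)
        fix x y z assume *: "(x, y) \<in> leq ?L" "(y, z) \<in> leq ?L"
        obtain A B where "x = h A" "y = h B" using *(1) by (rule leq_lindenbaumE)
        moreover obtain C where "z = h C" using *(2) by (rule leq_lindenbaumE)
        ultimately show "(x, z) \<in> leq ?L" using * by (auto intro: provable_trans)
      qed
      show "antisym (leq ?L)"
      proof (rule antisymI)
        fix x y assume *: "(x, y) \<in> leq ?L" "(y, x) \<in> leq ?L"
        obtain A B where "x = h A" "y = h B" using *(1) by (rule leq_lindenbaumE)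
        with * show "x = y" by (simp add: kernel)
      qed
    qed
  next
    fix x y z assume *: "(x, y) \<in> leq ?L" "z \<in> carrier ?L"
    obtain A B where "x = h A" "y = h B" using *(1) by (rule leq_lindenbaumE)
    moreover obtain C where "z = h C" using *(2) by auto
    ultimately show "(x \<otimes>\<^bsub>?L\<^esub> z, y \<otimes>\<^bsub>?L\<^esub> z) \<in> leq ?L"
      using * by (simp add: provable_mono)
  qed (auto simp: provable_empty)
qed

text \<open>Both sides turn unions into products and agree on singletons.\<close>

lemma eval_mset_lindenbaum: "eval_mset (lindenbaum \<Gamma> h) (\<lambda>p. h {#p#}) A = h A"
proof -
  interpret integral_comm_pomonoid "lindenbaum \<Gamma> h"
    by (rule integral_comm_pomonoid_lindenbaum)
  have e: "range (\<lambda>p. h {#p#}) \<subseteq> carrier (lindenbaum \<Gamma> h)"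
    by (auto simp: carrier_lindenbaum)
  show ?thesis
  proof (induction A)
    case empty
    show ?case by (simp add: eval_mset_def one_lindenbaum)
  next
    case (add p A)
    then show ?case
      using eval_mset_union[OF e, of "{#p#}" A] by (simp add: eval_mset_single[OF e] mult_lindenbaum)
  qed
qed

lemma satisfies_lindenbaum: "satisfies (lindenbaum \<Gamma> h) (\<lambda>p. h {#p#}) \<phi> \<longleftrightarrow> \<Gamma> \<turnstile> \<phi>"
  by (cases \<phi>) (simp add: satisfies_def eval_mset_lindenbaum leq_lindenbaum)

lemma is_model_lindenbaum: "is_model (lindenbaum \<Gamma> h) (\<lambda>p. h {#p#}) \<Gamma>"
  by (auto simp: is_model_def satisfies_lindenbaum carrier_lindenbaum provable_hyp)

end

section \<open>Realizing the classes inside an infinite type\<close>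

lemma countable_multisets:
  assumes "countable (UNIV :: 'v set)"
  shows "countable (UNIV :: 'v multiset set)"
proof -
  have "countable (lists (UNIV :: 'v set))" using assms by (rule countable_lists)
  then have "countable (mset ` lists (UNIV :: 'v set))" by (rule countable_image)
  then show ?thesis by (simp add: lists_UNIV surj_mset)
qed

text \<open>Choose one representative in each class and embed the countably many multisets into the
  given type.\<close>

lemma ex_map_with_kernel_interderivability:
  fixes \<Gamma> :: "'v mfd set"
  assumes "countable (UNIV :: 'v set)" and "infinite (UNIV :: 'a set)"
  obtains h :: "'v multiset \<Rightarrow> 'a"
  where "\<And>A B. h A = h B \<longleftrightarrow> \<Gamma> \<turnstile> (A \<Rrightarrow> B) \<and> \<Gamma> \<turnstile> (B \<Rrightarrow> A)"
proof -
  obtain f :: "nat \<Rightarrow> 'a" where f: "inj f"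
    using infinite_countable_subset[OF assms(2)] by blast
  define g where "g = f \<circ> to_nat_on (UNIV :: 'v multiset set)"
  have g: "inj g"
    unfolding g_def using f countable_multisets[OF assms(1)]
    by (intro inj_compose inj_on_to_nat_on)
  define R where "R A B \<longleftrightarrow> \<Gamma> \<turnstile> (A \<Rrightarrow> B) \<and> \<Gamma> \<turnstile> (B \<Rrightarrow> A)" for A B
  \<comment> \<open>As a predicate, \<open>R A\<close> is the class of \<open>A\<close>; this is the
    usual fact that classes of an equivalence coincide iff their members are related.\<close>
  have R: "R A = R B \<longleftrightarrow> R A B" for A B
    unfolding fun_eq_iff R_def by (meson provable_refl provable_trans)
  have "R A (Eps (R A))" for A
    by (rule someI[of _ A]) (simp add: R_def provable_refl)
  \<comment> \<open>Related multisets have the same class, hence the same chosen representative;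
    conversely, a shared representative is related to both.\<close>
  then have "g (Eps (R A)) = g (Eps (R B)) \<longleftrightarrow> R A B" for A B
    using g R by (metis injD)
  then show ?thesis using that[of "\<lambda>A. g (Eps (R A))"] unfolding R_def by blast
qed

section \<open>Soundness and completeness combined\<close>

theorem theorem3:
  fixes \<Gamma> :: "'v mfd set" and A B :: "'v multiset"
  assumes "countable (UNIV :: 'v set)" and "infinite (UNIV :: 'v set)"
    and "infinite (UNIV :: 'a set)"
  shows "\<Gamma> \<turnstile> (A \<Rrightarrow> B) \<longleftrightarrow> entails TYPE('a) \<Gamma> (A \<Rrightarrow> B)"
proof
  assume "\<Gamma> \<turnstile> (A \<Rrightarrow> B)"
  then show "entails TYPE('a) \<Gamma> (A \<Rrightarrow> B)"
    unfolding entails_def by (blast intro: integral_comm_pomonoid.soundness)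
next
  assume entails: "entails TYPE('a) \<Gamma> (A \<Rrightarrow> B)"
  obtain h :: "'v multiset \<Rightarrow> 'a"
    where h: "\<And>A B. h A = h B \<longleftrightarrow> \<Gamma> \<turnstile> (A \<Rrightarrow> B) \<and> \<Gamma> \<turnstile> (B \<Rrightarrow> A)"
    using ex_map_with_kernel_interderivability[OF assms(1,3)] by blast
  \<comment> \<open>Entailment is applied to the canonical model, where truth coincides with
    provability.\<close>
  have "satisfies (lindenbaum \<Gamma> h) (\<lambda>p. h {#p#}) (A \<Rrightarrow> B)"
    using entails integral_comm_pomonoid_lindenbaum[OF h] is_model_lindenbaum[OF h]
    unfolding entails_def by blast
  then show "\<Gamma> \<turnstile> (A \<Rrightarrow> B)" by (simp only: satisfies_lindenbaum[OF h])
qed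

end
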